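(* Let $(A_m)_{m\ge 0}$ be a sequence of real numbers such that $\sum_{m\ge 0}\frac{A_m}{m!}x^m$ converges for every real $x$, and put $f(x)=e^{-x}\sum_{m=0}^{\infty}\frac{A_m}{m!}x^m$. Then for all integers $n\ge 2$ and $N\ge 0$, \[ \left|A_n-\sum_{m=0}^{N}\frac{f^{(m)}(n)}{m!}\,\tau_m(n)\right|\le 17\,n^{\frac{N+1}{2}}\,E\!\left(f^{(N+1)};n\right). \]
   Context: $\Delta A_m=A_{m+1}-A_m$ and $\Delta^k$ is its $k$-fold iterate; one has $f^{(k)}(x)=e^{-x}\sum_m \frac{\Delta^kA_m}{m!}x^m$. For such $k$ and $r\ge 0$, $E(f^{(k)};r)=e^{-r}\sum_{m=0}^\infty\frac{|\Delta^kA_m|}{m!}r^m$. The polynomials $\tau_m(x)$ are defined by the generating function $\sum_{m\ge0}\frac{\tau_m(x)}{m!}z^m=\bigl((1+z)e^{-z}\bigr)^x$; for nonnegative integers $n$, $\tau_m(n)=n!\,[x^n]\bigl(e^x(x-n)^m\bigr)$, where $[x^n]F$ denotes the coefficient of $x^n$ in the power series of $F$. *)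

theory Defs
  imports "HOL-Analysis.Analysis" "HOL-Computational_Algebra.Computational_Algebra"
begin

definition forward_diff :: "(nat \<Rightarrow> real) \<Rightarrow> nat \<Rightarrow> real" where
  "forward_diff A = (\<lambda>m. A (Suc m) - A m)"

definition poisson_gf :: "(nat \<Rightarrow> real) \<Rightarrow> real \<Rightarrow> real" where
  "poisson_gf A x = exp (- x) * (\<Sum>m. A m / fact m * x ^ m)"

text \<open>If g is the Poisson generating function of B, then \<open>poisson_E B r\<close> is E(g; r).
  In particular, by \<open>higher_deriv_poisson_gf\<close> below,
  \<open>poisson_E ((forward_diff ^^ k) A) r\<close> is E(f^(k); r) for f = \<open>poisson_gf A\<close>.\<close>

definition poisson_E :: "(nat \<Rightarrow> real) \<Rightarrow> real \<Rightarrow> real" where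
  "poisson_E B r = exp (- r) * (\<Sum>m. \<bar>B m\<bar> / fact m * r ^ m)"

text \<open>The formal power ((1 + z) e^(-z))^x is (1 + w)^x with w = (1 + z) e^(-z) - 1,
  a series without constant term; (1 + w)^x is the binomial series.\<close>

definition tau :: "nat \<Rightarrow> real \<Rightarrow> real" where
  "tau m x = fact m *
     fps_nth (fps_compose (fps_binomial x) ((1 + fps_X) * fps_exp (- 1) - 1)) m"

lemma tau_polynomial: "\<exists>p :: real poly. \<forall>x. poly p x = tau m x"
proof -
  let ?w = "(1 + fps_X) * fps_exp (- 1) - 1 :: real fps"
  define g :: "nat \<Rightarrow> real poly" where
    "g i = smult (inverse (fact i)) (\<Prod>j<i. [:- of_nat j, 1:])" for i
  have g: "poly (g i) x = x gchoose i" for i x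
    by (simp add: g_def poly_prod gbinomial_prod_rev field_simps atLeast0LessThan)
  have "poly (smult (fact m) (\<Sum>i=0..m. smult (fps_nth (?w ^ i) m) (g i))) x = tau m x" for x
    by (simp add: tau_def fps_compose_nth poly_sum g mult.commute)
  then show ?thesis by blast
qed

lemma tau_of_nat:
  "tau m (real n) = fact m * fps_nth (((1 + fps_X) * fps_exp (- 1)) ^ n) m"
proof -
  let ?w = "(1 + fps_X) * fps_exp (- 1) - 1 :: real fps"
  have w0: "fps_nth ?w 0 = 0" by simp
  have "fps_compose (fps_binomial (real n)) ?w = fps_compose ((1 + fps_X) ^ n) ?w"
    by (simp add: fps_binomial_of_nat)
  also have "\<dots> = (fps_compose (1 + fps_X) ?w) ^ n"
    by (rule fps_compose_power[OF w0, symmetric])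
  also have "fps_compose (1 + fps_X) ?w = (1 + fps_X) * fps_exp (- 1)"
    using w0 by (simp add: fps_compose_add_distrib)
  finally show ?thesis by (simp add: tau_def)
qed

lemma tau_of_nat_coeff:
  "tau m (real n) = fact n * fps_nth (fps_exp 1 * (fps_X - fps_const (real n)) ^ m) n"
proof -
  let ?c = "- real n"
  have "tau m (real n) = fact m * fps_nth ((1 + fps_X) ^ n * fps_exp ?c) m"
    by (simp add: tau_of_nat power_mult_distrib fps_exp_power_mult)
  also have "\<dots> = (\<Sum>i=0..m. fact m * (of_nat (n choose i) * (?c ^ (m - i) / fact (m - i))))"
    by (simp add: fps_mult_nth sum_distrib_left binomial_gbinomial flip: fps_binomial_of_nat)
  also have "\<dots> = (\<Sum>i=0..m. if i \<le> n
      then fact n * (of_nat (m choose i) * ?c ^ (m - i) / fact (n - i)) else 0)"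
    by (intro sum.cong refl) (auto simp: binomial_fact field_simps)
  also have "\<dots> = fact n * fps_nth (fps_exp 1 * (fps_X + fps_const ?c) ^ m) n"
  proof -
    have "(fps_X + fps_const ?c) ^ m =
        (\<Sum>i\<le>m. fps_const (of_nat (m choose i) * ?c ^ (m - i)) * fps_X ^ i)"
      by (subst binomial_ring)
         (simp add: mult_ac fps_of_nat[symmetric] fps_const_power flip: fps_const_mult)
    then have "fps_exp 1 * (fps_X + fps_const ?c) ^ m =
        (\<Sum>i\<le>m. fps_const (of_nat (m choose i) * ?c ^ (m - i)) * (fps_exp 1 * fps_X ^ i))"
      by (simp add: sum_distrib_left mult_ac)
    then show ?thesis
      by (auto simp: fps_sum_nth fps_X_power_mult_right_nth sum_distrib_left atMost_atLeast0
               intro!: sum.cong)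
  qed
  also have "fps_X + fps_const ?c = fps_X - fps_const (real n)"
    by (simp flip: fps_const_neg)
  finally show ?thesis .
qed

lemma poisson_gf_deriv:
  assumes "\<And>x. summable (\<lambda>m. A m / fact m * x ^ m)"
  shows "summable (\<lambda>m. forward_diff A m / fact m * x ^ m)"
    and "(poisson_gf A has_real_derivative poisson_gf (forward_diff A) x) (at x)"
proof -
  let ?a = "\<lambda>m. A m / fact m"
  have d: "diffs ?a = (\<lambda>m. A (Suc m) / fact m)"
    by (rule ext) (simp add: diffs_def del: of_nat_Suc)
  have s: "summable (\<lambda>m. diffs ?a m * x ^ m)"
    by (rule termdiff_converges_all) (rule assms)
  have eq: "(\<lambda>m. forward_diff A m / fact m * x ^ m) =
      (\<lambda>m. diffs ?a m * x ^ m - ?a m * x ^ m)"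
    by (rule ext) (simp add: d forward_diff_def field_simps)
  show "summable (\<lambda>m. forward_diff A m / fact m * x ^ m)"
    unfolding eq by (intro summable_diff s assms)
  have sm: "(\<Sum>m. forward_diff A m / fact m * x ^ m) =
      (\<Sum>m. diffs ?a m * x ^ m) - (\<Sum>m. ?a m * x ^ m)"
    unfolding eq by (rule suminf_diff[symmetric]) (rule s, rule assms)
  have D: "((\<lambda>x. \<Sum>m. ?a m * x ^ m) has_real_derivative (\<Sum>m. diffs ?a m * x ^ m)) (at x)"
    by (rule termdiffs_strong_converges_everywhere) (rule assms)
  have p: "poisson_gf A = (\<lambda>x. exp (- x) * (\<Sum>m. ?a m * x ^ m))"
    by (rule ext) (simp add: poisson_gf_def)
  show "(poisson_gf A has_real_derivative poisson_gf (forward_diff A) x) (at x)"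
    unfolding p
    by (rule derivative_eq_intros D refl)+
       (simp only: poisson_gf_def sm, simp add: algebra_simps)
qed

lemma higher_deriv_poisson_gf:
  assumes "\<And>x. summable (\<lambda>m. A m / fact m * x ^ m)"
  shows "(deriv ^^ k) (poisson_gf A) = poisson_gf ((forward_diff ^^ k) A)"
proof -
  have "(\<forall>x. summable (\<lambda>m. (forward_diff ^^ k) A m / fact m * x ^ m)) \<and>
    (deriv ^^ k) (poisson_gf A) = poisson_gf ((forward_diff ^^ k) A)"
  proof (induction k)
    case 0
    then show ?case using assms by simp
  next
    case (Suc k)
    then have s: "\<And>x. summable (\<lambda>m. (forward_diff ^^ k) A m / fact m * x ^ m)" by blast
    have "deriv (poisson_gf ((forward_diff ^^ k) A)) =
        poisson_gf (forward_diff ((forward_diff ^^ k) A))"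
      by (rule ext) (rule DERIV_imp_deriv[OF poisson_gf_deriv(2)[OF s]])
    then show ?case using Suc poisson_gf_deriv(1)[OF s] by simp
  qed
  then show ?thesis by blast
qed

end

theory Submission
  imports Defs
begin

text \<open>Let P be the Poisson weights with mean n, and let a m = tau m n / m!. Repeated summation by
  parts around n gives, for every g, the average of g against P as the sum over l < r of
  u l times the l-th difference of g at n, plus an average of the r-th difference against a kernel
  built from r-fold tail sums of P. A three-term recurrence for these tail sums bounds the kernel by
  2 n^(r/2) P. The generating functions of a and u satisfy mutually adjoint differential
  equations, so they are inverse to each other; expanding every f^(m)(n) to total order N, the
  main terms therefore collapse to A n. The remaining error is at most
  2 n^((N+1)/2) E times the sum of the |a m| n^(-m/2), which is at most 17/2.\<close>

section \<open>Poisson weights with integer mean\<close>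

definition pois :: "nat \<Rightarrow> nat \<Rightarrow> real" where
  "pois n k = exp (- real n) * real n ^ k / fact k"

lemma pois_nonneg: "0 \<le> pois n k"
  by (simp add: pois_def)

lemma pois_Suc: "(1 + real k) * pois n (Suc k) = real n * pois n k"
  by (simp add: pois_def divide_simps)

text \<open>The ratio 1/2 is chosen because the sum of (1/2)^j over j > k is again (1/2)^k. The same
  majorant therefore survives every tail summation and serves all levels of
  \<open>rtail\<close>.\<close>

lemma pois_le_geometric: "pois n k \<le> exp (real n) * (1 / 2) ^ k"
proof -
  have e: "(2 * real n) ^ k / fact k \<le> exp (2 * real n)"
  proof -
    have "(\<Sum>j\<in>{k}. (2 * real n) ^ j / fact j) \<le> (\<Sum>j. (2 * real n) ^ j / fact j)"
      by (rule sum_le_suminf) (use summable_exp[of "2 * real n"] in \<open>auto simp: field_simps\<close>)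
    then show ?thesis by (simp add: exp_def field_simps)
  qed
  have "pois n k = exp (- real n) * (1 / 2) ^ k * ((2 * real n) ^ k / fact k)"
    by (simp add: pois_def power_mult_distrib power_one_over)
  also have "\<dots> \<le> exp (- real n) * (1 / 2) ^ k * exp (2 * real n)"
    using e by (intro mult_left_mono) auto
  also have "\<dots> = exp (- real n + 2 * real n) * (1 / 2) ^ k"
    by (simp only: exp_add mult_ac)
  finally show ?thesis by simp
qed

lemma pois_antimono: "n \<le> k \<Longrightarrow> pois n (Suc k) \<le> pois n k"
proof -
  assume "n \<le> k"
  then have "real n * pois n k \<le> (1 + real k) * pois n k"
    by (intro mult_right_mono pois_nonneg) simp
  then have "(1 + real k) * pois n (Suc k) \<le> (1 + real k) * pois n k"
    by (simp add: pois_Suc)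
  then show ?thesis by simp
qed

lemma pois_mono: "Suc k \<le> n \<Longrightarrow> pois n k \<le> pois n (Suc k)"
proof -
  assume "Suc k \<le> n"
  then have "(1 + real k) * pois n k \<le> real n * pois n k"
    by (intro mult_right_mono pois_nonneg) simp
  then have "(1 + real k) * pois n k \<le> (1 + real k) * pois n (Suc k)"
    by (simp add: pois_Suc)
  then show ?thesis by simp
qed

section \<open>Iterated tails of the Poisson distribution\<close>

text \<open>The tail is strict on the right but inclusive in \<open>ltail\<close>, so at k = n - 1
  the two first tails split the whole mass. In closed form level r + 1 is the sum of P(j) times
  (j-k-1 choose r) over j > k, respectively of P(j) times (k-j+r choose r) over j <= k.\<close>

primrec rtail :: "nat \<Rightarrow> nat \<Rightarrow> nat \<Rightarrow> real" where
  "rtail n 0 k = pois n k"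
| "rtail n (Suc r) k = (\<Sum>i. rtail n r (Suc (k + i)))"

primrec ltail :: "nat \<Rightarrow> nat \<Rightarrow> nat \<Rightarrow> real" where
  "ltail n 0 k = pois n k"
| "ltail n (Suc r) k = (\<Sum>j\<le>k. ltail n r j)"

declare rtail.simps(2)[simp del] ltail.simps(2)[simp del]

lemma rtail_bounds: "0 \<le> rtail n r k \<and> rtail n r k \<le> exp (real n) * (1 / 2) ^ k"
proof (induction r arbitrary: k)
  case 0
  then show ?case by (simp add: pois_nonneg pois_le_geometric)
next
  case (Suc r)
  have g: "(\<lambda>i. exp (real n) * (1 / 2) ^ Suc k * (1 / 2) ^ i) sums
      (exp (real n) * (1 / 2) ^ Suc k * 2)"
    using sums_mult[OF geometric_sums[of "1 / 2 :: real"], of "exp (real n) * (1 / 2) ^ Suc k"]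
    by simp
  have le: "rtail n r (Suc (k + i)) \<le> exp (real n) * (1 / 2) ^ Suc k * (1 / 2) ^ i" for i
    using Suc[of "Suc (k + i)"] by (simp add: power_add)
  have s: "summable (\<lambda>i. rtail n r (Suc (k + i)))"
    by (rule summable_comparison_test'[OF sums_summable[OF g], of 0])
       (use Suc le in \<open>simp only: real_norm_def abs_of_nonneg\<close>)
  have "rtail n (Suc r) k \<le> exp (real n) * (1 / 2) ^ Suc k * 2"
    using suminf_le[OF le s sums_summable[OF g]] sums_unique[OF g]
    by (simp add: rtail.simps(2))
  moreover have "0 \<le> rtail n (Suc r) k"
    using suminf_nonneg[OF s] Suc by (simp add: rtail.simps(2))
  ultimately show ?case by simp
qed

lemma rtail_nonneg: "0 \<le> rtail n r k"
  using rtail_bounds by blast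

lemma rtail_summable: "summable (\<lambda>i. rtail n r (Suc (k + i)))"
proof -
  have "summable (rtail n r)"
    by (rule summable_comparison_test'[of "\<lambda>k. exp (real n) * (1 / 2) ^ k" 0])
       (use rtail_bounds in \<open>auto intro!: summable_mult summable_geometric\<close>)
  then show ?thesis
    using summable_ignore_initial_segment[of "rtail n r" "Suc k"] by (simp add: add_ac)
qed

lemma rtail_Suc: "rtail n (Suc r) k = rtail n r (Suc k) + rtail n (Suc r) (Suc k)"
  using suminf_split_head[OF rtail_summable, of n r k]
  by (simp add: rtail.simps(2))

lemma rtail_tendsto_0: "(\<lambda>k. rtail n r k) \<longlonglongrightarrow> 0"
proof (rule tendsto_sandwich[OF _ _ tendsto_const])
  show "(\<lambda>k. exp (real n) * (1 / 2) ^ k) \<longlonglongrightarrow> 0"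
    by (intro tendsto_mult_right_zero LIMSEQ_power_zero) simp
qed (use rtail_bounds in auto)

text \<open>Controls the coefficient growing linearly in k in the recurrence below.\<close>

lemma linear_rtail_tendsto_0: "(\<lambda>k. real k * rtail n r k) \<longlonglongrightarrow> 0"
proof (rule tendsto_sandwich[OF _ _ tendsto_const])
  have "(\<lambda>k. exp (real n) * (real k * (1 / 2) ^ k)) \<longlonglongrightarrow> 0"
    by (intro tendsto_mult_right_zero powser_times_n_limit_0) simp
  then show "(\<lambda>k. real k * (exp (real n) * (1 / 2) ^ k)) \<longlonglongrightarrow> 0"
    by (simp add: mult_ac)
qed (use rtail_bounds in \<open>auto intro!: mult_left_mono always_eventually simp del: mult_le_cancel_left\<close>)

text \<open>The discrepancy D of the two sides is constant in k and tends to 0. Its increment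
  vanishes by \<open>pois_Suc\<close> at the bottom level, and by the recurrence one level lower at
  k + 1 otherwise.\<close>

lemma rtail_recurrence:
  "(1 + real r) * rtail n (Suc (Suc r)) k + (1 + real r + real k - real n) * rtail n (Suc r) k
    = real n * rtail n r k"
proof (induction r arbitrary: k)
  case (0 k)
  define D where "D k = rtail n (Suc (Suc 0)) k + (1 + real k - real n) * rtail n (Suc 0) k
    - real n * pois n k" for k
  have "D (Suc k) = D k" for k
    using rtail_Suc[of n "Suc 0" k] rtail_Suc[of n 0 k] pois_Suc[of k n]
    by (simp add: D_def algebra_simps)
  then have c: "D k = D 0" for k by (induction k) auto
  have "(\<lambda>k. rtail n (Suc (Suc 0)) k + ((1 - real n) * rtail n (Suc 0) k + real k * rtail n (Suc 0) k)
      - real n * rtail n 0 k) \<longlonglongrightarrow> 0 + ((1 - real n) * 0 + 0) - real n * 0"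
    by (intro tendsto_intros rtail_tendsto_0 linear_rtail_tendsto_0)
  then have "D \<longlonglongrightarrow> 0"
    by (simp add: D_def[abs_def] algebra_simps)
  with c[abs_def] have "D 0 = 0"
    by (metis LIMSEQ_unique tendsto_const)
  with c show ?case by (simp add: D_def)
next
  case (Suc r k)
  define D where "D k = (1 + real (Suc r)) * rtail n (Suc (Suc (Suc r))) k
    + (1 + real (Suc r) + real k - real n) * rtail n (Suc (Suc r)) k
    - real n * rtail n (Suc r) k" for k
  have "D (Suc k) = D k" for k
    using rtail_Suc[of n "Suc (Suc r)" k] rtail_Suc[of n "Suc r" k] rtail_Suc[of n r k]
      Suc[of "Suc k"]
    by (simp add: D_def algebra_simps)
  then have c: "D k = D 0" for k by (induction k) auto
  have "(\<lambda>k. (1 + real (Suc r)) * rtail n (Suc (Suc (Suc r))) k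
      + ((1 + real (Suc r) - real n) * rtail n (Suc (Suc r)) k + real k * rtail n (Suc (Suc r)) k)
      - real n * rtail n (Suc r) k)
      \<longlonglongrightarrow> (1 + real (Suc r)) * 0 + ((1 + real (Suc r) - real n) * 0 + 0) - real n * 0"
    by (intro tendsto_intros rtail_tendsto_0 linear_rtail_tendsto_0)
  then have "D \<longlonglongrightarrow> 0"
    by (simp add: D_def[abs_def] algebra_simps)
  with c[abs_def] have "D 0 = 0"
    by (metis LIMSEQ_unique tendsto_const)
  with c show ?case by (simp add: D_def)
qed

lemma ltail_nonneg: "0 \<le> ltail n r k"
  by (induction r arbitrary: k) (auto simp: pois_nonneg ltail.simps(2) intro: sum_nonneg)

lemma ltail_Suc: "ltail n (Suc r) (Suc k) = ltail n (Suc r) k + ltail n r (Suc k)"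
  by (simp add: ltail.simps(2))

lemma ltail_0: "ltail n r 0 = pois n 0"
  by (induction r) (auto simp: ltail.simps(2))

text \<open>Same differencing in k as for the right tails, but anchored at k = 0, where all levels
  equal P(0), instead of at infinity.\<close>

lemma ltail_recurrence:
  "(1 + real r) * ltail n (Suc (Suc r)) k
    = (1 + real r + real k - real n) * ltail n (Suc r) k + real n * ltail n r k"
proof (induction r arbitrary: k)
  case (0 k)
  show ?case
  proof (induction k)
    case 0
    then show ?case by (simp only: ltail_0) (simp add: algebra_simps)
  next
    case (Suc k)
    then show ?case
      using ltail_Suc[of n "Suc 0" k] ltail_Suc[of n 0 k] pois_Suc[of k n]
      by (simp add: algebra_simps)
  qed
next
  case (Suc r k)
  note IH = Suc
  show ?case
  proof (induction k)
    case 0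
    then show ?case by (simp only: ltail_0) (simp add: algebra_simps)
  next
    case (Suc k)
    then show ?case
      using ltail_Suc[of n "Suc (Suc r)" k] ltail_Suc[of n "Suc r" k] ltail_Suc[of n r k]
        IH[of "Suc k"]
      by (simp add: algebra_simps)
  qed
qed

text \<open>The difference of the two sides is monotone in k and vanishes at infinity; with the recurrence
  this turns the bound n P on the second tail into one of order n^(1/2) P on the first.\<close>

lemma rtail_1_square_le:
  assumes "n \<le> k"
  shows "(rtail n 1 k)\<^sup>2 \<le> 2 * pois n k * (rtail n 1 k + rtail n 2 k)"
proof -
  define Q where "Q k = 2 * rtail n 0 k * (rtail n 1 k + rtail n 2 k) - (rtail n 1 k)\<^sup>2" for k
  have dec: "Q (Suc k) \<le> Q k" if "n \<le> k" for k
  proof -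
    let ?p = "pois n (Suc k)" and ?r = "rtail n 1 (Suc k)" and ?t = "rtail n 2 (Suc k)"
    have 1: "rtail n 1 k = ?p + ?r" "rtail n 2 k = ?r + ?t"
      using rtail_Suc[of n 0 k] rtail_Suc[of n 1 k]
      by (simp_all add: numeral_2_eq_2)
    \<comment> \<open>Lowering P(k) to P(k+1) inside Q(k) leaves exactly Q(k+1) + ?p^2, so Q
      decreases.\<close>
    have "2 * ?p * (?p + ?r + (?r + ?t)) \<le> 2 * pois n k * (?p + ?r + (?r + ?t))"
      using pois_antimono[OF that] pois_nonneg[of n "Suc k"] rtail_nonneg[of n 1 "Suc k"] rtail_nonneg[of n 2 "Suc k"]
      by (intro mult_right_mono mult_left_mono add_nonneg_nonneg) auto
    moreover have "0 \<le> ?p * ?p" by simp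
    ultimately show ?thesis
      unfolding Q_def 1 rtail.simps(1) power2_eq_square
      by (simp only: algebra_simps)
  qed
  have "(\<lambda>k. 2 * rtail n 0 k * (rtail n 1 k + rtail n 2 k) - (rtail n 1 k)\<^sup>2)
      \<longlonglongrightarrow> 2 * 0 * (0 + 0) - 0\<^sup>2"
    by (intro tendsto_intros rtail_tendsto_0)
  then have "Q \<longlonglongrightarrow> 0" by (simp add: Q_def[abs_def])
  then have "(\<lambda>i. Q (i + k)) \<longlonglongrightarrow> 0" by (rule LIMSEQ_ignore_initial_segment)
  moreover have "decseq (\<lambda>i. Q (i + k))"
    using dec assms by (intro decseq_SucI) simp
  ultimately have "0 \<le> Q (0 + k)" by (metis decseq_ge)
  then show ?thesis by (simp add: Q_def)
qed

text \<open>Mirror image of the right-hand estimate, by induction from k = 0 with weights increasing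
  up to n. The second tail stands alone because \<open>ltail\<close> already includes the term at
  k.\<close>

lemma ltail_1_square_le: "k < n \<Longrightarrow> (ltail n 1 k)\<^sup>2 \<le> 2 * pois n k * ltail n 2 k"
proof (induction k)
  case 0
  then show ?case unfolding ltail_0 by (simp add: power2_eq_square)
next
  case (Suc k)
  let ?p = "pois n (Suc k)" and ?r = "ltail n 1 k" and ?t = "ltail n 2 k"
  have 1: "ltail n 1 (Suc k) = ?r + ?p" "ltail n 2 (Suc k) = ?t + (?r + ?p)"
    using ltail_Suc[of n 0 k] ltail_Suc[of n 1 k]
    by (simp_all add: numeral_2_eq_2)
  have "2 * pois n k * ?t \<le> 2 * ?p * ?t"
    using pois_mono[of k n] Suc.prems ltail_nonneg[of n 2 k]
    by (intro mult_right_mono mult_left_mono) auto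
  moreover have "0 \<le> ?p * ?p" by simp
  ultimately show ?case
    using Suc.IH[OF Suc_lessD[OF Suc.prems]] unfolding 1 power2_eq_square
    by (simp only: algebra_simps)
qed

lemma le_2_sqrt_mult_if_square_le:
  fixes x y :: real
  assumes "x\<^sup>2 \<le> 2 * y * (real n * y)" "0 \<le> y"
  shows "x \<le> 2 * (sqrt (real n) * y)"
proof (rule power2_le_imp_le)
  have "(2 * (sqrt (real n) * y))\<^sup>2 = 4 * (real n * y\<^sup>2)"
    by (simp add: power_mult_distrib)
  moreover have "2 * y * (real n * y) = 2 * (real n * y\<^sup>2)"
    by (simp add: power2_eq_square)
  moreover have "0 \<le> real n * y\<^sup>2" by simp
  ultimately show "x\<^sup>2 \<le> (2 * (sqrt (real n) * y))\<^sup>2"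
    using assms(1) by linarith
qed (use assms in auto)

text \<open>For k >= n the middle coefficient of the recurrence is nonnegative, so two levels cost
  at most a factor n. Odd levels start from the square estimate, which is where the factor 2 (a
  rounded sqrt 2) enters.\<close>

lemma rtail_le:
  assumes "n \<le> k"
  shows "rtail n r k \<le> 2 * (sqrt (real n) ^ r * pois n k)"
proof (induction r rule: less_induct)
  case (less r)
  have rec: "(1 + real r) * rtail n (Suc (Suc r)) k \<le> real n * rtail n r k" for r
  proof -
    have "0 \<le> (1 + real r + real k - real n) * rtail n (Suc r) k"
      using assms by (intro mult_nonneg_nonneg rtail_nonneg) simp
    then show ?thesis using rtail_recurrence[of r n k] by linarith
  qed
  consider "r = 0" | "r = 1" | q where "r = Suc (Suc q)"
    by (metis One_nat_def not0_implies_Suc)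
  then show ?case
  proof cases
    case 1
    then show ?thesis using pois_nonneg[of n k] by simp
  next
    case 2
    have "0 \<le> (real k - real n) * rtail n 1 k"
      using assms by (intro mult_nonneg_nonneg rtail_nonneg) simp
    then have "rtail n 1 k + rtail n 2 k \<le> real n * pois n k"
      using rtail_recurrence[of 0 n k]
      by (simp add: numeral_2_eq_2 algebra_simps)
    then have "(rtail n 1 k)\<^sup>2 \<le> 2 * pois n k * (real n * pois n k)"
      using rtail_1_square_le[OF assms] pois_nonneg[of n k]
      by (meson mult_left_mono mult_nonneg_nonneg order_trans zero_le_numeral)
    then show ?thesis
      using le_2_sqrt_mult_if_square_le[OF _ pois_nonneg] 2 by simp
  next
    case 3
    have "rtail n r k \<le> (1 + real q) * rtail n r k"
      using rtail_nonneg[of n r k] by (simp add: algebra_simps)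
    also have "\<dots> \<le> real n * rtail n q k" using rec[of q] 3 by simp
    also have "\<dots> \<le> real n * (2 * (sqrt (real n) ^ q * pois n k))"
      using less[of q] 3 by (intro mult_left_mono) auto
    also have "\<dots> = 2 * ((sqrt (real n) * sqrt (real n)) * sqrt (real n) ^ q * pois n k)"
      by simp
    finally show ?thesis using 3 by (simp only: power_Suc mult.assoc)
  qed
qed

lemma ltail_le:
  assumes "k < n"
  shows "ltail n r k \<le> 2 * (sqrt (real n) ^ r * pois n k)"
proof (induction r rule: less_induct)
  case (less r)
  consider "r = 0" | "r = 1" | q where "r = Suc (Suc q)"
    by (metis One_nat_def not0_implies_Suc)
  then show ?case
  proof cases
    case 1
    then show ?thesis using pois_nonneg[of n k] by simp
  next
    case 2
    have "0 \<le> (real n - real k - 1) * ltail n 1 k"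
      using assms by (intro mult_nonneg_nonneg ltail_nonneg) simp
    then have "ltail n 2 k \<le> real n * pois n k"
      using ltail_recurrence[of 0 n k]
      by (simp add: numeral_2_eq_2 algebra_simps)
    then have "(ltail n 1 k)\<^sup>2 \<le> 2 * pois n k * (real n * pois n k)"
      using ltail_1_square_le[OF assms] pois_nonneg[of n k]
      by (meson mult_left_mono mult_nonneg_nonneg order_trans zero_le_numeral)
    then show ?thesis
      using le_2_sqrt_mult_if_square_le[OF _ pois_nonneg] 2 by simp
  next
    case 3
    let ?s = "sqrt (real n)"
    let ?c = "2 * (?s ^ r * pois n k)"
    have s: "1 \<le> ?s" using assms by simp
    \<comment> \<open>On the left the middle term has the wrong sign to be dropped. Since k < n, its
      coefficient is at most q, and sqrt n >= 1 lifts the bound for level q + 1 to level r. Together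
      with the last term this makes 1 + q copies of ?c, matching the factor on the left.\<close>
    have "(1 + real q + real k - real n) * ltail n (Suc q) k \<le> real q * ltail n (Suc q) k"
      using assms by (intro mult_right_mono ltail_nonneg) simp
    also have "\<dots> \<le> real q * (2 * (?s ^ Suc q * pois n k))"
      using less[of "Suc q"] 3 by (intro mult_left_mono) auto
    also have "\<dots> \<le> real q * ?c"
      using s 3 pois_nonneg[of n k]
      by (intro mult_left_mono mult_right_mono power_increasing) auto
    finally have a: "(1 + real q + real k - real n) * ltail n (Suc q) k \<le> real q * ?c" .
    have "real n * ltail n q k \<le> real n * (2 * (?s ^ q * pois n k))"
      using less[of q] 3 by (intro mult_left_mono) auto
    also have "\<dots> = 2 * ((?s * ?s) * ?s ^ q * pois n k)" by simp
    also have "\<dots> = ?c" using 3 by (simp only: power_Suc mult.assoc)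
    finally have "(1 + real q) * ltail n r k \<le> (1 + real q) * ?c"
      using a ltail_recurrence[of q n k] 3 by (simp add: algebra_simps)
    then show ?thesis by simp
  qed
qed

section \<open>Expansion of Poisson averages in differences at the mean\<close>

text \<open>Each branch is summed from its own far end, which keeps the kernel small on both sides
  of n. Summation from the left flips the sign at every level, hence the factor (-1)^r.\<close>

definition tail_kernel :: "nat \<Rightarrow> nat \<Rightarrow> nat \<Rightarrow> real" where
  "tail_kernel n r k = (if k < n then (- 1) ^ r * ltail n r k else rtail n r k)"

text \<open>This is the sum of \<open>tail_kernel n r k\<close> over all k, i.e. the jump between the two
  branches of the next kernel; equivalently the mean of (X - n) gchoose r for X Poisson with mean n.\<close>

definition moment :: "nat \<Rightarrow> nat \<Rightarrow> real" where
  "moment n r = rtail n (Suc r) (n - 1) + (- 1) ^ r * ltail n (Suc r) (n - 1)"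

lemma abs_tail_kernel_le: "\<bar>tail_kernel n r k\<bar> \<le> 2 * (sqrt (real n) ^ r * pois n k)"
  using rtail_le[of n k r] ltail_le[of k n r] rtail_nonneg[of n r k] ltail_nonneg[of n r k]
  by (simp add: tail_kernel_def abs_mult power_abs)

text \<open>Inside each branch the next kernel is the negative antidifference of the current one.
  The branches meet only between n - 1 and n, which produces the jump.\<close>

lemma tail_kernel_Suc:
  assumes "0 < n"
  shows "tail_kernel n (Suc r) k = tail_kernel n (Suc r) (Suc k) + tail_kernel n r (Suc k)
    - (if k = n - 1 then moment n r else 0)"
proof -
  consider "Suc k < n" | "k = n - 1" | "n \<le> k" using assms by linarith
  then show ?thesis
  proof cases
    case 1
    then show ?thesis
      by (simp add: tail_kernel_def ltail_Suc algebra_simps)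
  next
    case 2
    then show ?thesis
      using assms rtail_Suc[of n r k] by (simp add: tail_kernel_def moment_def)
  next
    case 3
    then show ?thesis
      using assms rtail_Suc[of n r k] by (simp add: tail_kernel_def)
  qed
qed

lemma moment_0:
  assumes "0 < n"
  shows "moment n 0 = 1"
proof -
  have "pois n sums (exp (- real n) * exp (real n))"
    using sums_mult[OF exp_converges[of "real n"], of "exp (- real n)"]
    by (simp add: pois_def[abs_def] divide_inverse mult_ac)
  then have s: "pois n sums 1" by (simp flip: exp_add)
  have n: "Suc (n - 1 + i) = i + n" for i using assms by simp
  have "moment n 0 = (\<Sum>i. pois n (i + n)) + (\<Sum>j<n. pois n j)"
    using assms lessThan_Suc_atMost[of "n - 1"]
    by (simp add: moment_def rtail.simps(2) ltail.simps(2) n add.commute)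
  also have "\<dots> = 1"
    using suminf_split_initial_segment[OF sums_summable[OF s], of n] sums_unique[OF s] by simp
  finally show ?thesis .
qed

text \<open>At k = n - 1 the middle coefficient 1 + k - n is zero, so both second tails equal n
  P(n-1) and cancel.\<close>

lemma moment_1:
  assumes "0 < n"
  shows "moment n 1 = 0"
  using assms rtail_recurrence[of 0 n "n - 1"] ltail_recurrence[of 0 n "n - 1"]
  by (simp add: moment_def of_nat_diff)

text \<open>Add the right recurrence and (-1)^r times the left one, both at level r + 1 and k = n -
  1. There the middle coefficient reduces to r + 1, and the signs match those in
  \<open>moment\<close>.\<close>

lemma moment_recurrence:
  assumes "0 < n"
  shows "(real r + 2) * moment n (Suc (Suc r)) + (real r + 1) * moment n (Suc r)
    = real n * moment n r"
proof -
  have k: "real (n - 1) = real n - 1" using assms by simp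
  have "(- 1) ^ r * ((real r + 2) * ltail n (Suc (Suc (Suc r))) (n - 1))
      = (- 1) ^ r * ((real r + 1) * ltail n (Suc (Suc r)) (n - 1) + real n * ltail n (Suc r) (n - 1))"
    using ltail_recurrence[of "Suc r" n "n - 1"]
    unfolding k by (intro arg_cong[of _ _ "\<lambda>x. (- 1) ^ r * x"]) (simp add: algebra_simps)
  then show ?thesis
    using rtail_recurrence[of "Suc r" n "n - 1"]
    unfolding moment_def k by (simp add: algebra_simps)
qed

lemma summable_pois_abs:
  assumes "\<And>x. summable (\<lambda>m. g m / fact m * x ^ m)"
  shows "summable (\<lambda>k. pois n k * \<bar>g k\<bar>)"
proof -
  have "summable (\<lambda>m. norm (g m / fact m * real n ^ m))"
    \<comment> \<open>Convergence at the larger point n + 1 gives absolute convergence at n.\<close>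
    by (rule powser_insidea[OF assms[of "real n + 1"]]) simp
  then have "summable (\<lambda>m. exp (- real n) * norm (g m / fact m * real n ^ m))"
    by (rule summable_mult)
  then show ?thesis by (simp add: pois_def abs_mult mult_ac)
qed

lemma poisson_E_eq:
  assumes "\<And>x. summable (\<lambda>m. g m / fact m * x ^ m)"
  shows "poisson_E g (real n) = (\<Sum>k. pois n k * \<bar>g k\<bar>)"
proof -
  have "summable (\<lambda>m. norm (g m / fact m * real n ^ m))"
    by (rule powser_insidea[OF assms[of "real n + 1"]]) simp
  then have "summable (\<lambda>m. \<bar>g m\<bar> / fact m * real n ^ m)"
    by (simp add: abs_mult)
  then show ?thesis
    by (simp add: poisson_E_def pois_def mult_ac flip: suminf_mult)
qed

lemma poisson_gf_eq:
  assumes "\<And>x. summable (\<lambda>m. g m / fact m * x ^ m)"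
  shows "poisson_gf g (real n) = (\<Sum>k. pois n k * g k)"
  using assms[of "real n"] by (simp add: poisson_gf_def pois_def mult_ac flip: suminf_mult)

lemma norm_tail_kernel_mult_le:
  "norm (tail_kernel n r k * y) \<le> 2 * sqrt (real n) ^ r * (pois n k * \<bar>y\<bar>)"
  using mult_right_mono[OF abs_tail_kernel_le[of n r k], of "\<bar>y\<bar>"]
  by (simp add: abs_mult mult_ac)

lemma summable_tail_kernel:
  assumes "\<And>x. summable (\<lambda>m. g m / fact m * x ^ m)"
  shows "summable (\<lambda>k. tail_kernel n r k * g k)"
  by (rule summable_comparison_test'[OF summable_mult[OF summable_pois_abs[OF assms, of n],
        of "2 * sqrt (real n) ^ r"], of 0])
     (rule norm_tail_kernel_mult_le)

lemma tail_kernel_sum_by_parts: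
  assumes n: "0 < n" and g: "\<And>x. summable (\<lambda>m. g m / fact m * x ^ m)"
  shows "(\<Sum>k. tail_kernel n r k * g k)
    = moment n r * g n + (\<Sum>k. tail_kernel n (Suc r) k * forward_diff g k)"
proof -
  let ?H = "\<lambda>k. tail_kernel n (Suc r) k * g k"
  have "?H \<longlonglongrightarrow> 0"
    by (rule summable_LIMSEQ_zero[OF summable_tail_kernel[OF g]])
  from telescope_sums[OF this]
  have 1: "(\<lambda>k. ?H (Suc k) - ?H k) sums (0 - ?H 0)" .
  have "(\<lambda>k. tail_kernel n r k * g k) sums (\<Sum>k. tail_kernel n r k * g k)"
    by (rule summable_sums[OF summable_tail_kernel[OF g]])
  then have 2: "(\<lambda>k. tail_kernel n r (Suc k) * g (Suc k)) sums
      ((\<Sum>k. tail_kernel n r k * g k) - tail_kernel n r 0 * g 0)"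
    using sums_Suc_iff[of "\<lambda>k. tail_kernel n r k * g k"
        "(\<Sum>k. tail_kernel n r k * g k) - tail_kernel n r 0 * g 0"] by simp
  have 3: "(\<lambda>k. if k = n - 1 then moment n r * g (Suc k) else 0) sums (moment n r * g n)"
    using sums_single[of "n - 1" "\<lambda>k. moment n r * g (Suc k)"] n by simp
  have eq: "tail_kernel n (Suc r) k * forward_diff g k = (?H (Suc k) - ?H k)
      + tail_kernel n r (Suc k) * g (Suc k)
      - (if k = n - 1 then moment n r * g (Suc k) else 0)" for k
  proof -
    have "tail_kernel n (Suc r) k * g (Suc k) = (tail_kernel n (Suc r) (Suc k)
        + tail_kernel n r (Suc k) - (if k = n - 1 then moment n r else 0)) * g (Suc k)"
      using tail_kernel_Suc[OF n, of r k] by simp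
    then show ?thesis
      by (simp add: forward_diff_def algebra_simps split: if_splits)
  qed
  have "(\<lambda>k. tail_kernel n (Suc r) k * forward_diff g k) sums
      ((0 - ?H 0) + ((\<Sum>k. tail_kernel n r k * g k) - tail_kernel n r 0 * g 0) - moment n r * g n)"
    unfolding eq by (intro sums_add sums_diff 1 2 3)
  \<comment> \<open>The boundary terms at 0 left by the telescoping and by the index shift
    cancel.\<close>
  moreover have "tail_kernel n (Suc r) 0 = - tail_kernel n r 0"
    using n by (simp add: tail_kernel_def ltail_0)
  ultimately show ?thesis by (simp add: sums_iff)
qed

lemma summable_forward_diff:
  assumes "\<And>x. summable (\<lambda>m. A m / fact m * x ^ m)"
  shows "summable (\<lambda>m. (forward_diff ^^ r) A m / fact m * x ^ m)"
  using assms
proof (induction r arbitrary: x)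
  case (Suc r)
  then show ?case using poisson_gf_deriv(1)[of "(forward_diff ^^ r) A" x] by simp
qed simp

lemma poisson_gf_expansion_error:
  assumes n: "0 < n" and A: "\<And>x. summable (\<lambda>m. A m / fact m * x ^ m)"
  shows "\<bar>poisson_gf A (real n) - (\<Sum>l<r. moment n l * (forward_diff ^^ l) A n)\<bar>
    \<le> 2 * sqrt (real n) ^ r * poisson_E ((forward_diff ^^ r) A) (real n)"
proof -
  note S = summable_forward_diff[OF A]
  have "poisson_gf A (real n) = (\<Sum>l<r. moment n l * (forward_diff ^^ l) A n)
      + (\<Sum>k. tail_kernel n r k * (forward_diff ^^ r) A k)"
  proof (induction r)
    case 0
    have "tail_kernel n 0 = pois n" by (simp add: tail_kernel_def fun_eq_iff)
    then show ?case by (simp add: poisson_gf_eq[OF A])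
  next
    case (Suc r)
    then show ?case using tail_kernel_sum_by_parts[OF n S, of r r] by simp
  qed
  moreover have "\<bar>\<Sum>k. tail_kernel n r k * (forward_diff ^^ r) A k\<bar>
      \<le> (\<Sum>k. 2 * sqrt (real n) ^ r * (pois n k * \<bar>(forward_diff ^^ r) A k\<bar>))"
    unfolding real_norm_def[symmetric, of "suminf _"]
    by (rule norm_suminf_le[OF norm_tail_kernel_mult_le])
       (intro summable_mult summable_pois_abs S)
  ultimately show ?thesis
    by (simp add: poisson_E_eq[OF S] suminf_mult[OF summable_pois_abs[OF S]])
qed

section \<open>The coefficients of the powers of (1 + z) exp (- z)\<close>

text \<open>By \<open>tau_of_nat\<close>, the m-th coefficient is
  \<open>tau m (real n) / fact m\<close>.\<close>

definition tau_gf :: "nat \<Rightarrow> real fps" where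
  "tau_gf n = ((1 + fps_X) * fps_exp (- 1)) ^ n"

text \<open>The logarithmic derivative of (1 + z) exp(-z) is -z / (1 + z); multiplying by 1 + z
  avoids the quotient.\<close>

lemma tau_gf_ode: "(1 + fps_X) * fps_deriv (tau_gf n) = - (of_nat n * fps_X * tau_gf n)"
proof (cases n)
  case 0
  then show ?thesis by (simp add: tau_gf_def)
next
  case (Suc p)
  let ?w = "(1 + fps_X) * fps_exp (- 1) :: real fps"
  have w: "fps_deriv ?w = - (fps_X * fps_exp (- 1))"
    by (simp add: algebra_simps flip: fps_const_neg)
  have "fps_deriv (tau_gf n) = of_nat n * fps_deriv ?w * ?w ^ p"
    unfolding tau_gf_def Suc fps_deriv_power fps_of_nat diff_Suc_1 by (rule refl)
  then have "(1 + fps_X) * fps_deriv (tau_gf n) = - (of_nat n * fps_X * (?w * ?w ^ p))"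
    unfolding w by (simp only: mult_minus_left mult_minus_right mult_ac)
  then show ?thesis by (simp only: tau_gf_def Suc power_Suc)
qed

lemma fps_nth_one_plus_X_deriv:
  "fps_nth ((1 + fps_X) * fps_deriv F) m = (real m + 1) * fps_nth F (Suc m) + real m * fps_nth F m"
  by (cases m) (simp_all add: distrib_right algebra_simps)

lemma fps_nth_of_nat_X_mult:
  "fps_nth (of_nat n * fps_X * F) m = (if m = 0 then 0 else real n * fps_nth F (m - 1))"
  by (simp add: mult.assoc flip: fps_of_nat)

lemma tau_gf_recurrence:
  "(real m + 2) * fps_nth (tau_gf n) (Suc (Suc m)) + (real m + 1) * fps_nth (tau_gf n) (Suc m)
    = - (real n * fps_nth (tau_gf n) m)"
  using arg_cong[OF tau_gf_ode[of n], of "\<lambda>F. fps_nth F (Suc m)"]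
  unfolding fps_neg_nth fps_nth_one_plus_X_deriv fps_nth_of_nat_X_mult
  by (simp add: algebra_simps)

lemma tau_gf_nth_0: "fps_nth (tau_gf n) 0 = 1"
  by (simp add: tau_gf_def fps_power_zeroth)

lemma tau_gf_nth_1: "fps_nth (tau_gf n) 1 = 0"
  using arg_cong[OF tau_gf_ode[of n], of "\<lambda>F. fps_nth F 0"]
  by (simp add: fps_nth_one_plus_X_deriv fps_nth_of_nat_X_mult)

text \<open>The series of \<open>moment\<close> is the mean of (1 + z)^(X - n), that is exp(n z) (1
  + z)^(-n). Here this is seen from its logarithmic derivative n z / (1 + z), opposite to that of
  \<open>tau_gf\<close>: the product has derivative zero and constant term 1.\<close>

lemma tau_gf_moment_inverse:
  assumes "0 < n"
  shows "tau_gf n * Abs_fps (moment n) = 1"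
proof -
  let ?F = "tau_gf n" and ?U = "Abs_fps (moment n)"
  have U: "(1 + fps_X) * fps_deriv ?U = of_nat n * fps_X * ?U"
  proof (rule fps_ext)
    fix m
    show "fps_nth ((1 + fps_X) * fps_deriv ?U) m = fps_nth (of_nat n * fps_X * ?U) m"
      unfolding fps_nth_one_plus_X_deriv fps_nth_of_nat_X_mult fps_nth_Abs_fps
      using moment_1[OF assms] moment_recurrence[OF assms, of "m - 1"]
      by (cases m) (simp_all add: algebra_simps)
  qed
  have "(1 + fps_X) * fps_deriv (?F * ?U)
      = ((1 + fps_X) * fps_deriv ?F) * ?U + ?F * ((1 + fps_X) * fps_deriv ?U)"
    by (simp add: algebra_simps)
  also have "\<dots> = 0" unfolding tau_gf_ode U by (simp add: algebra_simps)
  finally have "(1 + fps_X) * fps_deriv (?F * ?U) = 0" .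
  moreover have "(1 + fps_X :: real fps) \<noteq> 0"
    by (metis fps_X_nth fps_add_nth fps_one_nth fps_zero_nth add_0_right zero_neq_one)
  ultimately have "fps_deriv (?F * ?U) = 0" by (metis mult_eq_0_iff)
  then have "?F * ?U = fps_const (fps_nth (?F * ?U) 0)"
    by (simp only: fps_deriv_eq_0_iff)
  then show ?thesis by (simp add: tau_gf_nth_0 moment_0[OF assms])
qed

lemma sum_normalised_tau_gf_le:
  assumes n: "2 \<le> n"
  shows "(\<Sum>m\<le>N. \<bar>fps_nth (tau_gf n) m\<bar> / sqrt (real n) ^ m) \<le> 17 / 2"
proof -
  let ?s = "sqrt (real n)"
  define b where "b m = \<bar>fps_nth (tau_gf n) m\<bar> / ?s ^ m" for m
  have s: "0 < ?s" using n by simp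
  \<comment> \<open>A rational upper bound for 1 / sqrt 2, the worst case n = 2.\<close>
  have s': "1 / ?s \<le> 7072 / 10000"
  proof -
    have "10000 / 7072 \<le> ?s" using n by (intro real_le_rsqrt) (simp add: power2_eq_square)
    then show ?thesis using s by (simp add: field_simps)
  qed
  have b0: "b m \<ge> 0" for m using s by (simp add: b_def)
  \<comment> \<open>Dividing by n^(m/2) absorbs the factor n of the last term and leaves 1 / sqrt n
    on the middle one, so the recurrence becomes uniform in n.\<close>
  have rec: "(real m + 2) * b (Suc (Suc m)) \<le> 7072 / 10000 * ((real m + 1) * b (Suc m)) + b m"
    for m
  proof -
    let ?a = "\<lambda>m. \<bar>fps_nth (tau_gf n) m\<bar>"
    have "(real m + 2) * ?a (Suc (Suc m))
        = \<bar>- (real n * fps_nth (tau_gf n) m) - (real m + 1) * fps_nth (tau_gf n) (Suc m)\<bar>"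
      unfolding tau_gf_recurrence[symmetric] by (simp add: abs_mult)
    also have "\<dots> \<le> real n * ?a m + (real m + 1) * ?a (Suc m)"
      by (rule order_trans[OF abs_triangle_ineq4]) (simp add: abs_mult)
    finally have "(real m + 2) * ?a (Suc (Suc m)) / ?s ^ Suc (Suc m)
        \<le> (real n * ?a m + (real m + 1) * ?a (Suc m)) / ?s ^ Suc (Suc m)"
      using s by (intro divide_right_mono) auto
    also have "\<dots> = (?s * ?s) * ?a m / ?s ^ Suc (Suc m) + (real m + 1) * ?a (Suc m) / ?s ^ Suc (Suc m)"
      by (simp add: add_divide_distrib)
    also have "\<dots> = b m + 1 / ?s * ((real m + 1) * b (Suc m))"
      using s by (simp add: b_def field_simps del: real_sqrt_mult_self)
    also have "\<dots> \<le> b m + 7072 / 10000 * ((real m + 1) * b (Suc m))"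
      using s' b0 by (intro add_left_mono mult_right_mono) auto
    finally show ?thesis by (simp add: b_def)
  qed
  have b01: "b 0 = 1" "b 1 = 0"
    using tau_gf_nth_0[of n] tau_gf_nth_1[of n] by (simp_all add: b_def)
  have b2: "b 2 \<le> 1 / 2" using rec[of 0] b01 by (simp add: numeral_2_eq_2)
  have b3: "b 3 \<le> 236 / 1000" using rec[of 1] b01 b2 by (simp add: eval_nat_numeral)
  have b4: "b 4 \<le> 2502 / 10000" using rec[of 2] b2 b3 by (simp add: eval_nat_numeral)
  \<comment> \<open>The weights 10 and 22/10 make the left-hand side nonincreasing in M once M is at least 4.\<close>
  have potential: "(\<Sum>m\<le>M. b m) + 10 * b M + 22 / 10 * b (M - 1) \<le> 17 / 2" if "4 \<le> M" for M
    using that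
  proof (induction M rule: dec_induct)
    case base
    show ?case using b01 b2 b3 b4 by (simp add: eval_nat_numeral)
  next
    case (step M)
    obtain m where m: "M = Suc m" "3 \<le> m" using step by (cases M) auto
    \<comment> \<open>Here m >= 3 gives 1 / (m + 2) <= 1/5. The weights then fit: 11 * 0.7072 + 2.2
      <= 10 and 11 / 5 = 2.2.\<close>
    have "b (Suc (Suc m)) \<le> 7072 / 10000 * b (Suc m) + b m / 5"
    proof -
      have "7072 / 10000 * ((real m + 1) * b (Suc m)) + b m
          \<le> (real m + 2) * (7072 / 10000 * b (Suc m) + b m / 5)"
      proof -
        have "5 * b m \<le> (real m + 2) * b m"
          using m b0 by (intro mult_right_mono) auto
        moreover have "(real m + 1) * b (Suc m) \<le> (real m + 2) * b (Suc m)"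
          using b0 by (intro mult_right_mono) auto
        moreover have "(real m + 2) * (7072 / 10000 * b (Suc m) + b m / 5)
            = 7072 / 10000 * ((real m + 2) * b (Suc m)) + (real m + 2) * b m / 5"
          by (simp add: algebra_simps add_divide_distrib)
        ultimately show ?thesis by linarith
      qed
      then have "(real m + 2) * b (Suc (Suc m)) \<le> (real m + 2) * (7072 / 10000 * b (Suc m) + b m / 5)"
        using rec[of m] by linarith
      then show ?thesis by simp
    qed
    then show ?case using step m b0[of m] b0[of "Suc m"] by simp
  qed
  \<comment> \<open>The potential bound starts at index 4; smaller N are covered by enlarging the
    sum.\<close>
  have "(\<Sum>m\<le>N. b m) \<le> (\<Sum>m\<le>max 4 N. b m)"
    using b0 by (intro sum_mono2) auto
  also have "\<dots> \<le> 17 / 2"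
    using potential[of "max 4 N"] b0[of "max 4 N"] b0[of "max 4 N - 1"] by linarith
  finally show ?thesis by (simp add: b_def)
qed

section \<open>Cancellation of the main terms and final estimate\<close>

lemma tau_moment_telescope:
  assumes n: "0 < n"
  shows "(\<Sum>m\<le>N. fps_nth (tau_gf n) m * (\<Sum>l<Suc N - m. moment n l * h (l + m))) = h 0"
proof -
  let ?a = "fps_nth (tau_gf n)"
  have "(\<Sum>m\<le>N. ?a m * (\<Sum>l<Suc N - m. moment n l * h (l + m)))
      = (\<Sum>(m, l)\<in>{(m, l). m + l \<le> N}. ?a m * moment n l * h (l + m))"
  proof -
    have "{(m, l). m + l \<le> N} = (SIGMA m:{..N}. {..<Suc N - m})" by auto
    then show ?thesis by (simp add: sum.Sigma sum_distrib_left mult.assoc)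
  qed
  \<comment> \<open>Grouping by k = l + m turns the inner sum into a Cauchy product coefficient of
    the two inverse series, so only k = 0 survives.\<close>
  also have "\<dots> = (\<Sum>k\<le>N. \<Sum>m\<le>k. ?a m * moment n (k - m) * h (k - m + m))"
    by (rule sum.triangle_reindex_eq)
  also have "\<dots> = (\<Sum>k\<le>N. fps_nth (tau_gf n * Abs_fps (moment n)) k * h k)"
    by (intro sum.cong refl) (simp add: fps_mult_nth sum_distrib_right atMost_atLeast0)
  also have "\<dots> = h 0"
    by (simp add: tau_gf_moment_inverse[OF n] if_distrib[of "\<lambda>x. x * _"] cong: if_cong)
  finally show ?thesis .
qed

theorem theorem2:
  fixes A :: "nat \<Rightarrow> real" and f :: "real \<Rightarrow> real" and n N :: nat
  assumes "\<And>x :: real. summable (\<lambda>m. A m / fact m * x ^ m)"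
    and "f = poisson_gf A"
    and "n \<ge> 2"
  shows "\<bar>A n - (\<Sum>m = 0..N. (deriv ^^ m) f (real n) / fact m * tau m (real n))\<bar>
    \<le> 17 * real n powr ((real N + 1) / 2)
        * poisson_E ((forward_diff ^^ (N + 1)) A) (real n)"
proof -
  let ?s = "sqrt (real n)" and ?a = "fps_nth (tau_gf n)"
  let ?E = "poisson_E ((forward_diff ^^ (N + 1)) A) (real n)"
  have n: "0 < n" and s: "0 < ?s" using assms(3) by simp_all
  have E: "0 \<le> ?E"
    unfolding poisson_E_eq[OF summable_forward_diff[OF assms(1)]]
    by (intro suminf_nonneg summable_pois_abs summable_forward_diff assms(1))
       (simp add: pois_nonneg)
  \<comment> \<open>The m-th derivative is expanded to N + 1 - m terms, so every remainder involves
    the same difference of order N + 1 and hence the same ?E.\<close>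
  define d where "d m = poisson_gf ((forward_diff ^^ m) A) (real n)
    - (\<Sum>l<Suc N - m. moment n l * (forward_diff ^^ (l + m)) A n)" for m
  have d: "\<bar>d m\<bar> \<le> 2 * ?s ^ (Suc N - m) * ?E" if "m \<le> N" for m
  proof -
    have "(forward_diff ^^ l) ((forward_diff ^^ m) A) = (forward_diff ^^ (l + m)) A" for l
      by (simp add: funpow_add)
    then show ?thesis
      using poisson_gf_expansion_error[OF n summable_forward_diff[OF assms(1), of m], of "Suc N - m"]
        that by (simp add: d_def)
  qed
  have "(\<Sum>m = 0..N. (deriv ^^ m) f (real n) / fact m * tau m (real n))
      = (\<Sum>m\<le>N. ?a m * poisson_gf ((forward_diff ^^ m) A) (real n))"
    by (simp add: assms(2) higher_deriv_poisson_gf[OF assms(1)] tau_of_nat tau_gf_def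
        atMost_atLeast0 mult.commute)
  also have "\<dots> = (\<Sum>m\<le>N. ?a m * (\<Sum>l<Suc N - m. moment n l * (forward_diff ^^ (l + m)) A n))
      + (\<Sum>m\<le>N. ?a m * d m)"
    by (simp add: d_def algebra_simps flip: sum.distrib)
  also have "\<dots> = A n + (\<Sum>m\<le>N. ?a m * d m)"
    using tau_moment_telescope[OF n, of "\<lambda>k. (forward_diff ^^ k) A n" N] by simp
  finally have "\<bar>A n - (\<Sum>m = 0..N. (deriv ^^ m) f (real n) / fact m * tau m (real n))\<bar>
      = \<bar>\<Sum>m\<le>N. ?a m * d m\<bar>" by simp
  also have "\<dots> \<le> (\<Sum>m\<le>N. \<bar>?a m\<bar> * \<bar>d m\<bar>)"
    using sum_abs[of "\<lambda>m. ?a m * d m" "{..N}"] by (simp only: abs_mult)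
  \<comment> \<open>Pulling out the full power sqrt(n)^(N+1) leaves the weight n^(-m/2) on each
    coefficient, which is the sum bounded by 17/2.\<close>
  also have "\<dots> \<le> (\<Sum>m\<le>N. 2 * ?s ^ Suc N * ?E * (\<bar>?a m\<bar> / ?s ^ m))"
  proof (intro sum_mono)
    fix m assume m: "m \<in> {..N}"
    have "\<bar>?a m\<bar> * \<bar>d m\<bar> \<le> \<bar>?a m\<bar> * (2 * ?s ^ (Suc N - m) * ?E)"
      using d m by (intro mult_left_mono) auto
    also have "?s ^ (Suc N - m) = ?s ^ Suc N / ?s ^ m"
      using s m by (intro power_diff) auto
    finally show "\<bar>?a m\<bar> * \<bar>d m\<bar> \<le> 2 * ?s ^ Suc N * ?E * (\<bar>?a m\<bar> / ?s ^ m)"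
      by (simp add: mult_ac)
  qed
  also have "\<dots> = 2 * ?s ^ Suc N * ?E * (\<Sum>m\<le>N. \<bar>?a m\<bar> / ?s ^ m)"
    by (simp only: sum_distrib_left)
  also have "\<dots> \<le> 2 * ?s ^ Suc N * ?E * (17 / 2)"
    using s E by (intro mult_left_mono sum_normalised_tau_gf_le assms(3)) auto
  also have "\<dots> = 17 * real n powr ((real N + 1) / 2) * ?E"
  proof -
    have "?s ^ Suc N = ?s powr real (Suc N)" using s by (rule powr_realpow[symmetric])
    also have "\<dots> = real n powr ((real N + 1) / 2)"
      using n by (simp add: powr_half_sqrt[symmetric] powr_powr add.commute)
    finally show ?thesis by simp
  qed
  finally show ?thesis .
qed

end
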